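(* Let $A$ be a central simple division algebra of degree $d$ over a field $F$ of characteristic $0$ or greater than $d$, and let $\varphi=N_{A/F}$ be its (reduced) norm. Then Scharlau's norm principle holds for $\varphi$ for all finite field extensions of $F$; that is, for every finite field extension $K/F$ and every $a\in K^\times$ with $a\varphi_K\cong\varphi_K$, one has $N_{K/F}(a)\varphi\cong\varphi$.
   Context: The reduced norm $\varphi=N_{A/F}$ is viewed as a form (homogeneous polynomial) of degree $d$ on the $F$-vector space $A$, and $\varphi_K$ is its scalar extension to $A\otimes_FK$ (the same homogeneous polynomial over $K$, i.e. the reduced norm of $A\otimes_FK$ over $K$). Two forms $(V_1,\varphi_1)$, $(V_2,\varphi_2)$ are isomorphic, $\varphi_1\cong\varphi_2$, if there is a bijective linear map $f:V_1\to V_2$ with $\varphi_2(f(v))=\varphi_1(v)$ for all $v\in V_1$. *)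

theory Defs
  imports
    "Jordan_Normal_Form.Determinant"
    "HOL-Algebra.Algebraic_Closure_Type"
    "HOL-Library.FuncSet"
    "HOL-Library.Poly_Mapping"
begin

definition is_basis :: "('f::field \<Rightarrow> 'v::ab_group_add \<Rightarrow> 'v) \<Rightarrow> 'v set \<Rightarrow> bool" where
  "is_basis scale B \<longleftrightarrow> \<not> module.dependent scale B \<and> module.span scale B = UNIV"

text \<open>
  The scalars act through \<open>scale\<close>; centrality says that the centre is exactly the image
  \<open>F \<cdot> 1\<close> of the base field. Division rings are simple, so simplicity needs no separate axiom.
  The degree is the square root of the dimension.
\<close>

locale central_division_algebra = vector_space scale
  for scale :: "'f::field \<Rightarrow> 'a::division_ring \<Rightarrow> 'a" and d :: nat +
  assumes scale_mult_left: "scale c x * y = scale c (x * y)"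
    and scale_mult_right: "x * scale c y = scale c (x * y)"
    and central: "(\<And>x. z * x = x * z) \<Longrightarrow> z \<in> range (\<lambda>c. scale c 1)"
    and finite_dimensional: "\<exists>B. finite B \<and> is_basis scale B"
    and dim_eq: "dim UNIV = d\<^sup>2"

text \<open>
  A splitting of \<open>A\<close> over an algebraic closure of \<open>F\<close>, given by the restriction
  \<open>\<rho>(a) = \<Phi>(a \<otimes> 1)\<close> of an isomorphism \<open>\<Phi>\<close> from \<open>A \<otimes> F\<^sup>a\<^sup>c\<close> onto the
  \<open>d \<times> d\<close> matrices. The last clause says that the \<open>F\<^sup>a\<^sup>c\<close>-linear extension of \<open>\<rho>\<close> is
  bijective, the elements of \<open>A \<otimes> F\<^sup>a\<^sup>c\<close> being written in an \<open>F\<close>-basis \<open>B\<close> of \<open>A\<close>.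
\<close>

definition is_splitting ::
    "('f::field \<Rightarrow> 'a::division_ring \<Rightarrow> 'a) \<Rightarrow> nat \<Rightarrow> ('a \<Rightarrow> 'f alg_closure mat) \<Rightarrow> bool" where
  "is_splitting scale d \<rho> \<longleftrightarrow>
     (\<forall>a. \<rho> a \<in> carrier_mat d d) \<and>
     \<rho> 1 = 1\<^sub>m d \<and>
     (\<forall>a b. \<rho> (a + b) = \<rho> a + \<rho> b) \<and>
     (\<forall>a b. \<rho> (a * b) = \<rho> a * \<rho> b) \<and>
     (\<forall>c a. \<rho> (scale c a) = to_ac c \<cdot>\<^sub>m \<rho> a) \<and>
     (\<exists>B. finite B \<and> is_basis scale B \<and>
        bij_betw (\<lambda>y. mat d d (\<lambda>ij. \<Sum>b\<in>B. y b * (\<rho> b $$ ij)))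
          (B \<rightarrow>\<^sub>E UNIV) (carrier_mat d d))"

text \<open>
  The determinants below are independent of the splitting and lie in \<open>F\<close>, so this predicate
  holds for exactly one function \<open>\<phi>\<close>.
\<close>

definition is_reduced_norm ::
    "('f::field \<Rightarrow> 'a::division_ring \<Rightarrow> 'a) \<Rightarrow> nat \<Rightarrow> ('a \<Rightarrow> 'f) \<Rightarrow> bool" where
  "is_reduced_norm scale d \<phi> \<longleftrightarrow>
     (\<exists>\<rho>. is_splitting scale d \<rho> \<and> (\<forall>a. to_ac (\<phi> a) = det (\<rho> a)))"

text \<open>Field extensions \<open>K/F\<close> are given by an embedding \<open>h\<close> of \<open>F\<close> into \<open>K\<close>.\<close>

definition ext_scale :: "('f::field \<Rightarrow> 'k::field) \<Rightarrow> 'f \<Rightarrow> 'k \<Rightarrow> 'k" where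
  "ext_scale h c x = h c * x"

definition finite_field_extension :: "('f::field \<Rightarrow> 'k::field) \<Rightarrow> bool" where
  "finite_field_extension h \<longleftrightarrow>
     field_hom h \<and> (\<exists>B. finite B \<and> is_basis (ext_scale h) B)"

text \<open>
  The norm of \<open>a\<close> is the determinant of the \<open>F\<close>-linear map \<open>x \<mapsto> a * x\<close> on \<open>K\<close>, computed in some
  ordered basis; the choice does not matter.
\<close>

definition field_norm :: "('f::field \<Rightarrow> 'k::field) \<Rightarrow> 'k \<Rightarrow> 'f" where
  "field_norm h a =
     (let bs = (SOME bs. distinct bs \<and> is_basis (ext_scale h) (set bs)) in
      det (mat (length bs) (length bs)
        (\<lambda>(i, j). module.representation (ext_scale h) (set bs) (a * bs ! j) (bs ! i))))"

text \<open>
  The \<open>K\<close>-vector space \<open>W\<close>, together with the map \<open>\<iota>(v) = v \<otimes> 1\<close>, is a model of \<open>V \<otimes> K\<close>: the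
  map \<open>\<iota>\<close> is semilinear along \<open>h\<close>, and the induced \<open>K\<close>-linear map from \<open>V \<otimes> K\<close> to \<open>W\<close> is an
  isomorphism. The latter is expressed by a basis of \<open>V\<close> going over to a basis of \<open>W\<close>; if this
  holds for one basis of \<open>V\<close>, it holds for all of them.
\<close>

definition is_scalar_extension ::
    "('f::field \<Rightarrow> 'k::field) \<Rightarrow> ('f \<Rightarrow> 'v::ab_group_add \<Rightarrow> 'v) \<Rightarrow>
     ('k \<Rightarrow> 'w::ab_group_add \<Rightarrow> 'w) \<Rightarrow> ('v \<Rightarrow> 'w) \<Rightarrow> bool" where
  "is_scalar_extension h scaleV scaleW \<iota> \<longleftrightarrow>
     vector_space scaleV \<and> vector_space scaleW \<and>
     (\<forall>u v. \<iota> (u + v) = \<iota> u + \<iota> v) \<and>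
     (\<forall>c v. \<iota> (scaleV c v) = scaleW (h c) (\<iota> v)) \<and>
     (\<exists>B. is_basis scaleV B \<and> inj_on \<iota> B \<and> is_basis scaleW (\<iota> ` B))"

text \<open>
  Multivariate polynomials map exponent vectors to coefficients. The polynomial is evaluated after
  applying \<open>h\<close> to its coefficients.
\<close>

definition eval_poly_along ::
    "('f::zero \<Rightarrow> 'k::comm_semiring_1) \<Rightarrow> (('b \<Rightarrow>\<^sub>0 nat) \<Rightarrow>\<^sub>0 'f) \<Rightarrow> ('b \<Rightarrow> 'k) \<Rightarrow> 'k" where
  "eval_poly_along h p x =
     (\<Sum>m\<in>Poly_Mapping.keys p.
        h (Poly_Mapping.lookup p m) * (\<Prod>b\<in>Poly_Mapping.keys m. x b ^ Poly_Mapping.lookup m b))"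

definition homogeneous_poly :: "nat \<Rightarrow> 'b set \<Rightarrow> (('b \<Rightarrow>\<^sub>0 nat) \<Rightarrow>\<^sub>0 'f::zero) \<Rightarrow> bool" where
  "homogeneous_poly d B p \<longleftrightarrow>
     (\<forall>m\<in>Poly_Mapping.keys p. Poly_Mapping.keys m \<subseteq> B \<and>
        (\<Sum>b\<in>Poly_Mapping.keys m. Poly_Mapping.lookup m b) = d)"

text \<open>
  \<open>\<phi>\<close> and \<open>\<psi>\<close> are given by the same homogeneous polynomial \<open>p\<close> of degree \<open>d\<close> with coefficients
  in \<open>F\<close>, the former in the coordinates of a basis \<open>B\<close> of \<open>V\<close> and the latter in those of the basis
  \<open>{b \<otimes> 1 | b \<in> B}\<close> of \<open>V \<otimes> K\<close>. If \<open>F\<close> has more than \<open>d\<close> elements, as it does in characteristic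
  \<open>0\<close> or greater than \<open>d\<close>, then \<open>\<phi>\<close> determines \<open>p\<close> and hence \<open>\<psi>\<close>.
\<close>

definition is_form_extension ::
    "('f::field \<Rightarrow> 'k::field) \<Rightarrow> ('f \<Rightarrow> 'v::ab_group_add \<Rightarrow> 'v) \<Rightarrow>
     ('k \<Rightarrow> 'w::ab_group_add \<Rightarrow> 'w) \<Rightarrow> ('v \<Rightarrow> 'w) \<Rightarrow> nat \<Rightarrow> ('v \<Rightarrow> 'f) \<Rightarrow> ('w \<Rightarrow> 'k) \<Rightarrow> bool" where
  "is_form_extension h scaleV scaleW \<iota> d \<phi> \<psi> \<longleftrightarrow>
     (\<exists>B p. finite B \<and> is_basis scaleV B \<and> inj_on \<iota> B \<and> is_basis scaleW (\<iota> ` B) \<and>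
        homogeneous_poly d B p \<and>
        (\<forall>x. \<phi> (\<Sum>b\<in>B. scaleV (x b) b) = eval_poly_along id p x) \<and>
        (\<forall>y. \<psi> (\<Sum>b\<in>B. scaleW (y b) (\<iota> b)) = eval_poly_along h p y))"

definition forms_isomorphic ::
    "('f::field \<Rightarrow> 'v::ab_group_add \<Rightarrow> 'v) \<Rightarrow> ('v \<Rightarrow> 'f) \<Rightarrow>
     ('f \<Rightarrow> 'w::ab_group_add \<Rightarrow> 'w) \<Rightarrow> ('w \<Rightarrow> 'f) \<Rightarrow> bool" where
  "forms_isomorphic scale1 \<phi>1 scale2 \<phi>2 \<longleftrightarrow>
     (\<exists>f. Vector_Spaces.linear scale1 scale2 f \<and> bij f \<and> (\<forall>v. \<phi>2 (f v) = \<phi>1 v))"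

end

theory Submission
  imports Defs
begin

text \<open>
  Evaluating the isomorphism at \<open>1\<close> shows that \<open>a\<close> is a reduced norm from \<open>A \<otimes> K\<close>, say of
  \<open>\<Sum> b \<otimes> y b\<close>. Conversely, if \<open>N(a)\<close> is the reduced norm of some nonzero \<open>u\<close> in \<open>A\<close>, then left
  multiplication by \<open>u\<close> is the desired isomorphism. To find \<open>u\<close>, let \<open>K\<close> act on itself by
  \<open>n \<times> n\<close> matrices \<open>R(x)\<close> over \<open>F\<close>, so that \<open>\<Sum> R(y b) b\<close> is an \<open>n \<times> n\<close> matrix over \<open>A\<close>.
  Splitting \<open>A\<close> turns it into an \<open>nd \<times> nd\<close> matrix over the algebraic closure, whose determinant
  is computed in two ways. Gaussian elimination over the division ring \<open>A\<close> shows that it is a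
  reduced norm from \<open>A\<close>. Triangularizing the commuting matrices \<open>R(x)\<close> simultaneously, with diagonal
  entries \<open>\<chi> i x\<close>, shows that it is the product of the \<open>\<chi> i a\<close>, which is \<open>N(a)\<close>.
  The last step needs the polynomial defining the form to agree with the determinant over the
  algebraic closure and not only over \<open>F\<close>, which holds because \<open>F\<close> has more than \<open>d\<close> elements.
\<close>

section \<open>Block matrices and elimination over a division ring\<close>

text \<open>\<open>G i j k l\<close> is the entry \<open>(k, l)\<close> of the block \<open>(i, j)\<close>.\<close>

definition block_mat :: "nat \<Rightarrow> nat \<Rightarrow> (nat \<Rightarrow> nat \<Rightarrow> nat \<Rightarrow> nat \<Rightarrow> 'a) \<Rightarrow> 'a mat" where
  "block_mat n d G = mat (n * d) (n * d) (\<lambda>(r, s). G (r div d) (s div d) (r mod d) (s mod d))"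

lemma block_mat_carrier [simp]: "block_mat n d G \<in> carrier_mat (n * d) (n * d)"
  by (simp add: block_mat_def)

lemma block_index:
  fixes r :: nat
  assumes "r < n * d"
  shows "r div d < n" "r mod d < d"
  using assms by (auto simp: less_mult_imp_div_less intro!: mod_less_divisor gr0I)

lemma block_mat_cong:
  assumes "\<And>i j k l. \<lbrakk>i < n; j < n; k < d; l < d\<rbrakk> \<Longrightarrow> G i j k l = H i j k l"
  shows "block_mat n d G = block_mat n d H"
  unfolding block_mat_def by (rule eq_matI) (auto intro!: assms dest: block_index)

lemma sum_lessThan_mult:
  "(\<Sum>r<n * d. f (r div d) (r mod d)) = (\<Sum>i<n. \<Sum>k<d. f i k)" for n d :: nat
proof -
  have "(\<Sum>r<n * d. f (r div d) (r mod d)) = (\<Sum>i<n. \<Sum>r\<in>{i * d..<i * d + d}. f (r div d) (r mod d))"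
    by (simp add: sum.nat_group)
  also have "\<dots> = (\<Sum>i<n. \<Sum>k<d. f i k)"
  proof (rule sum.cong[OF refl])
    fix i
    have "(\<Sum>r\<in>{i * d..<i * d + d}. f (r div d) (r mod d)) = (\<Sum>k\<in>{0..<d}. f ((k + i * d) div d) ((k + i * d) mod d))"
      using sum.shift_bounds_nat_ivl[of "\<lambda>r. f (r div d) (r mod d)" 0 "i * d" d]
      by (simp add: add.commute)
    also have "\<dots> = (\<Sum>k<d. f i k)"
      by (rule sum.cong) auto
    finally show "(\<Sum>r\<in>{i * d..<i * d + d}. f (r div d) (r mod d)) = (\<Sum>k<d. f i k)" .
  qed
  finally show ?thesis .
qed

lemma block_mat_mult:
  fixes G H :: "nat \<Rightarrow> nat \<Rightarrow> nat \<Rightarrow> nat \<Rightarrow> 'a :: semiring_0"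
  shows "block_mat n d G * block_mat n d H =
    block_mat n d (\<lambda>i j k l. \<Sum>t<n. \<Sum>u<d. G i t k u * H t j u l)"
proof (rule eq_matI)
  fix r s
  assume "r < dim_row (block_mat n d (\<lambda>i j k l. \<Sum>t<n. \<Sum>u<d. G i t k u * H t j u l))"
    and "s < dim_col (block_mat n d (\<lambda>i j k l. \<Sum>t<n. \<Sum>u<d. G i t k u * H t j u l))"
  then have "r < n * d" "s < n * d"
    by (simp_all add: block_mat_def)
  then show "(block_mat n d G * block_mat n d H) $$ (r, s) =
      block_mat n d (\<lambda>i j k l. \<Sum>t<n. \<Sum>u<d. G i t k u * H t j u l) $$ (r, s)"
    using sum_lessThan_mult[of "\<lambda>t u. G (r div d) t (r mod d) u * H t (s div d) u (s mod d)" d n]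
    by (simp add: block_mat_def scalar_prod_def atLeast0LessThan)
qed (simp_all add: block_mat_def)

lemma transpose_block_mat:
  "transpose_mat (block_mat n d G) = block_mat n d (\<lambda>i j k l. G j i l k)"
  by (rule eq_matI) (auto simp: block_mat_def)

text \<open>Splitting off the first block row and column sets up the induction on the number of
  blocks.\<close>

lemma block_mat_Suc:
  "block_mat (Suc n) d G =
    four_block_mat (mat d d (\<lambda>(k, l). G 0 0 k l))
      (mat d (n * d) (\<lambda>(k, s). G 0 (Suc (s div d)) k (s mod d)))
      (mat (n * d) d (\<lambda>(r, l). G (Suc (r div d)) 0 (r mod d) l))
      (block_mat n d (\<lambda>i j. G (Suc i) (Suc j)))"
\<comment> \<open>For \<open>d = 0\<close> both sides are empty. Otherwise shifting an index by
  \<open>d\<close> raises its quotient by one and keeps its remainder.\<close>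
proof (cases "d = 0")
  case False
  then show ?thesis
    by (intro eq_matI) (auto simp: block_mat_def le_div_geq le_mod_geq not_less)
qed (auto intro!: eq_matI simp: block_mat_def)

lemma det_block_mat_Suc:
  fixes G :: "nat \<Rightarrow> nat \<Rightarrow> nat \<Rightarrow> nat \<Rightarrow> 'a :: idom"
  assumes "\<And>i k l. \<lbrakk>i < n; k < d; l < d\<rbrakk> \<Longrightarrow> G (Suc i) 0 k l = 0"
  shows "det (block_mat (Suc n) d G) =
    det (mat d d (\<lambda>(k, l). G 0 0 k l)) * det (block_mat n d (\<lambda>i j. G (Suc i) (Suc j)))"
proof -
  have "mat (n * d) d (\<lambda>(r, l). G (Suc (r div d)) 0 (r mod d) l) = 0\<^sub>m (n * d) d"
    by (rule eq_matI) (auto intro!: assms dest: block_index)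
  then show ?thesis
    unfolding block_mat_Suc
    by (subst det_four_block_mat_lower_left_zero[where n = d and m = "n * d"]) auto
qed

lemma det_block_mat_upper_triangular:
  fixes G :: "nat \<Rightarrow> nat \<Rightarrow> nat \<Rightarrow> nat \<Rightarrow> 'a :: idom"
  assumes "\<And>i j k l. \<lbrakk>i < n; j < i; k < d; l < d\<rbrakk> \<Longrightarrow> G i j k l = 0"
  shows "det (block_mat n d G) = (\<Prod>i<n. det (mat d d (\<lambda>(k, l). G i i k l)))"
  using assms
proof (induction n arbitrary: G)
  case 0
  then show ?case by (simp add: block_mat_def)
next
  case (Suc n)
  have "det (block_mat n d (\<lambda>i j. G (Suc i) (Suc j))) =
      (\<Prod>i<n. det (mat d d (\<lambda>(k, l). G (Suc i) (Suc i) k l)))"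
    by (rule Suc.IH) (simp add: Suc.prems)
  then show ?case
    by (simp add: det_block_mat_Suc Suc.prems prod.lessThan_Suc_shift del: prod.lessThan_Suc)
qed

text \<open>Transposition reduces this to the upper triangular case. It also transposes the diagonal
  blocks, which keeps their determinants.\<close>

lemma det_block_mat_lower_triangular:
  fixes G :: "nat \<Rightarrow> nat \<Rightarrow> nat \<Rightarrow> nat \<Rightarrow> 'a :: idom"
  assumes "\<And>i j k l. \<lbrakk>j < n; i < j; k < d; l < d\<rbrakk> \<Longrightarrow> G i j k l = 0"
  shows "det (block_mat n d G) = (\<Prod>i<n. det (mat d d (\<lambda>(k, l). G i i k l)))"
proof -
  have "det (block_mat n d G) = det (block_mat n d (\<lambda>i j k l. G j i l k))"
    using det_transpose[OF block_mat_carrier[of n d G]] by (simp add: transpose_block_mat)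
  also have "\<dots> = (\<Prod>i<n. det (mat d d (\<lambda>(k, l). G i i l k)))"
    by (rule det_block_mat_upper_triangular) (simp add: assms)
  also have "\<dots> = (\<Prod>i<n. det (mat d d (\<lambda>(k, l). G i i k l)))"
  proof (rule prod.cong[OF refl])
    fix i
    have "transpose_mat (mat d d (\<lambda>(k, l). G i i k l)) = mat d d (\<lambda>(k, l). G i i l k)"
      by (rule eq_matI) auto
    then show "det (mat d d (\<lambda>(k, l). G i i l k)) = det (mat d d (\<lambda>(k, l). G i i k l))"
      using det_transpose[of "mat d d (\<lambda>(k, l). G i i k l)" d] by simp
  qed
  finally show ?thesis .
qed

section \<open>Elimination over a division ring represented by matrices\<close>

locale matrix_representation =
  fixes \<rho> :: "'a::division_ring \<Rightarrow> 'k::field mat" and d :: nat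
  assumes rep_carrier [simp]: "\<rho> x \<in> carrier_mat d d"
    and rep_one: "\<rho> 1 = 1\<^sub>m d"
    and rep_add: "\<rho> (x + y) = \<rho> x + \<rho> y"
    and rep_mult: "\<rho> (x * y) = \<rho> x * \<rho> y"
begin

lemma rep_dim [simp]: "dim_row (\<rho> x) = d" "dim_col (\<rho> x) = d"
  using rep_carrier[of x] by (auto simp del: rep_carrier)

lemma mat_rep [simp]: "mat d d (($$) (\<rho> x)) = \<rho> x"
  by (rule eq_matI) auto

lemma rep_zero_index: "k < d \<Longrightarrow> l < d \<Longrightarrow> \<rho> 0 $$ (k, l) = 0"
  using rep_add[of 0 0] by (metis add_0 add_cancel_right_right index_add_mat(1) rep_dim)

lemma rep_sum_index:
  assumes "k < d" "l < d"
  shows "\<rho> (\<Sum>i\<in>I. f i) $$ (k, l) = (\<Sum>i\<in>I. \<rho> (f i) $$ (k, l))"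
  by (induction I rule: infinite_finite_induct) (use assms in \<open>simp_all add: rep_zero_index rep_add\<close>)

lemma rep_mult_index:
  assumes "k < d" "l < d"
  shows "\<rho> (x * y) $$ (k, l) = (\<Sum>u<d. \<rho> x $$ (k, u) * \<rho> y $$ (u, l))"
  using assms by (simp add: rep_mult scalar_prod_def atLeast0LessThan)

text \<open>The map induced by \<open>\<rho>\<close> from n by n matrices over the division ring to
  nd by nd matrices over the field; \<open>rep_mat_mult\<close> shows that it is
  multiplicative.\<close>

definition rep_mat :: "nat \<Rightarrow> (nat \<Rightarrow> nat \<Rightarrow> 'a) \<Rightarrow> 'k mat" where
  "rep_mat n M = block_mat n d (\<lambda>i j k l. \<rho> (M i j) $$ (k, l))"

lemma rep_mat_mult: "rep_mat n M * rep_mat n N = rep_mat n (\<lambda>i j. \<Sum>t<n. M i t * N t j)"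
  unfolding rep_mat_def block_mat_mult
  by (rule block_mat_cong) (simp add: rep_sum_index rep_mult_index)

text \<open>The row operations of the elimination are of this kind: their diagonal blocks are
  identity matrices.\<close>

lemma det_rep_mat_unitriangular:
  assumes "\<And>i. i < n \<Longrightarrow> M i i = 1"
    and "(\<forall>i<n. \<forall>j<i. M i j = 0) \<or> (\<forall>j<n. \<forall>i<j. M i j = 0)"
  shows "det (rep_mat n M) = 1"
proof -
  have "det (rep_mat n M) = (\<Prod>i<n. det (mat d d (\<lambda>(k, l). \<rho> (M i i) $$ (k, l))))"
    using assms(2) unfolding rep_mat_def
    by (elim disjE; intro det_block_mat_upper_triangular det_block_mat_lower_triangular)
      (auto simp: rep_zero_index)
  also have "\<dots> = 1"
    by (simp add: assms(1), simp add: rep_one)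
  finally show ?thesis .
qed

lemma det_rep_mat_mult: "det (rep_mat n (\<lambda>i j. \<Sum>t<n. M i t * N t j)) = det (rep_mat n M) * det (rep_mat n N)"
  unfolding rep_mat_mult[symmetric] rep_mat_def
  by (rule det_mult[OF block_mat_carrier block_mat_carrier])

lemma det_rep_mat_Suc:
  assumes "\<And>i. i < n \<Longrightarrow> M (Suc i) 0 = 0"
  shows "det (rep_mat (Suc n) M) = det (\<rho> (M 0 0)) * det (rep_mat n (\<lambda>i j. M (Suc i) (Suc j)))"
  unfolding rep_mat_def
  by (subst det_block_mat_Suc) (simp_all add: assms rep_zero_index)

text \<open>Row operations over the division ring do not change the determinant and make the matrix
  block upper triangular.\<close>

lemma det_rep_mat_is_norm: "\<exists>v. det (rep_mat n M) = det (\<rho> v)"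
proof (induction n arbitrary: M)
  case 0
  have "det (rep_mat 0 M) = det (\<rho> 1)"
    by (simp add: rep_mat_def block_mat_def rep_one)
  then show ?case by blast
next
  case (Suc n)
  \<comment> \<open>Once the first column is clear below the corner, the determinant splits into two
    factors, the second a norm by induction, and multiplicativity merges them into one.\<close>
  have cleared: "\<exists>v. det (rep_mat (Suc n) M) = det (\<rho> v)"
    if zero: "\<And>i. i < n \<Longrightarrow> M (Suc i) 0 = 0" for M
  proof -
    obtain v where v: "det (rep_mat n (\<lambda>i j. M (Suc i) (Suc j))) = det (\<rho> v)"
      using Suc.IH by blast
    have "det (rep_mat (Suc n) M) = det (\<rho> (M 0 0 * v))"
      by (simp add: det_rep_mat_Suc zero v rep_mult det_mult[where n = d])
    then show ?thesis by blast
  qed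
  have pivot: "\<exists>v. det (rep_mat (Suc n) M) = det (\<rho> v)" if nz: "M 0 0 \<noteq> 0" for M
  proof -
    \<comment> \<open>Left multiplication by \<open>L\<close> subtracts from each later row the
      multiple of row 0 that clears column 0. The factor \<open>inverse (M 0 0)\<close> stands on
      the right of \<open>M i 0\<close>, since entries need not commute.\<close>
    define L where "L i j = (if i = j then 1 else if j = 0 then - M i 0 * inverse (M 0 0) else 0)"
      for i j :: nat
    define N where "N i j = (\<Sum>t<Suc n. L i t * M t j)" for i j
    have "N (Suc i) 0 = 0" if "i < n" for i
    proof -
      have "N (Suc i) 0 = (\<Sum>t<Suc n. (if t = 0 then - M (Suc i) 0 else 0) +
          (if t = Suc i then M (Suc i) 0 else 0))"
        unfolding N_def by (rule sum.cong) (auto simp: L_def mult.assoc nz)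
      also have "\<dots> = 0"
        unfolding sum.distrib using that by (simp del: sum.lessThan_Suc)
      finally show ?thesis .
    qed
    then obtain v where "det (rep_mat (Suc n) N) = det (\<rho> v)"
      using cleared by blast
    moreover have "det (rep_mat (Suc n) L) = 1"
      by (rule det_rep_mat_unitriangular) (auto simp: L_def)
    ultimately show ?thesis
      using det_rep_mat_mult[of "Suc n" L M] unfolding N_def[abs_def] by (metis mult_1)
  qed
  show ?case
  proof (cases "\<forall>i<n. M (Suc i) 0 = 0")
    case True
    then show ?thesis by (intro cleared) auto
  next
    case False
    then obtain m where m: "m < n" "M (Suc m) 0 \<noteq> 0" by blast
    show ?thesis
    proof (cases "M 0 0 = 0")
      case True
      \<comment> \<open>Adding row \<open>Suc m\<close> to row 0 produces a nonzero pivot. Unlike a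
        row exchange, this operation is unitriangular.\<close>
      define L where "L i j = (if i = j then 1 else if i = 0 \<and> j = Suc m then 1 else 0 :: 'a)"
        for i j :: nat
      define N where "N i j = (\<Sum>t<Suc n. L i t * M t j)" for i j
      have "N 0 0 = (\<Sum>t<Suc n. if t = Suc m then M (Suc m) 0 else 0)"
        unfolding N_def by (rule sum.cong) (auto simp: L_def True)
      then have "N 0 0 \<noteq> 0"
        using m by (simp del: sum.lessThan_Suc)
      then obtain v where "det (rep_mat (Suc n) N) = det (\<rho> v)"
        using pivot by blast
      moreover have "det (rep_mat (Suc n) L) = 1"
        by (rule det_rep_mat_unitriangular) (auto simp: L_def)
      ultimately show ?thesis
        using det_rep_mat_mult[of "Suc n" L M] unfolding N_def[abs_def] by (metis mult_1)
    qed (use pivot in blast)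
  qed
qed

end

section \<open>Simultaneous triangularization\<close>

lemma invertible_mat_inverse:
  fixes A :: "'a::field mat"
  assumes "A \<in> carrier_mat n n" "det A \<noteq> 0"
  obtains B where "B \<in> carrier_mat n n" "A * B = 1\<^sub>m n" "B * A = 1\<^sub>m n"
  using det_non_zero_imp_unit[OF assms, of undefined] that
  by (auto simp: Units_def ring_mat_def)


text \<open>Among the nonzero polynomials p with \<open>p(A) v = 0\<close>, one of least degree has
  a root r. Writing \<open>p = (X - r) q\<close>, the vector \<open>q(A) v\<close> is nonzero by
  minimality, lies in \<open>E\<close>, and is an eigenvector for r.\<close>

lemma exists_eigenvector_in_invariant_subspace:
  fixes A :: "'a::alg_closed_field mat"
  assumes A: "A \<in> carrier_mat n n"
    and E: "E \<subseteq> carrier_vec n"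
    and add: "\<And>u v. u \<in> E \<Longrightarrow> v \<in> E \<Longrightarrow> u + v \<in> E"
    and smult: "\<And>c v. v \<in> E \<Longrightarrow> c \<cdot>\<^sub>v v \<in> E"
    and invariant: "\<And>v. v \<in> E \<Longrightarrow> A *\<^sub>v v \<in> E"
    and v: "v \<in> E" "v \<noteq> 0\<^sub>v n"
  shows "\<exists>w\<in>E. w \<noteq> 0\<^sub>v n \<and> (\<exists>c. A *\<^sub>v w = c \<cdot>\<^sub>v w)"
proof -
  \<comment> \<open>\<open>g j\<close> is the j-th power of \<open>A\<close> applied to
    \<open>v\<close>, and \<open>act p\<close> is \<open>p(A) v\<close>.\<close>
  define g where "g j = ((\<lambda>w. A *\<^sub>v w) ^^ j) v" for j
  define act where "act p = vec n (\<lambda>i. \<Sum>j\<le>Polynomial.degree p. poly.coeff p j * g j $ i)" for p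
  have gE: "g j \<in> E" for j
    by (induction j) (simp_all add: g_def v invariant)
  then have g_dim [simp]: "dim_vec (g j) = n" for j
    using E carrier_vecD by blast
  have g_Suc: "g (Suc j) = A *\<^sub>v g j" for j
    by (simp add: g_def)
  \<comment> \<open>Padding with zero coefficients lets polynomials of different degrees be compared
    over one range of summation.\<close>
  have act_index: "act p $ i = (\<Sum>j\<le>N. poly.coeff p j * g j $ i)" if "Polynomial.degree p \<le> N" "i < n" for p N i
  proof -
    have "act p $ i = (\<Sum>j\<le>Polynomial.degree p. poly.coeff p j * g j $ i)"
      using that by (simp add: act_def)
    also have "\<dots> = (\<Sum>j\<le>N. poly.coeff p j * g j $ i)"
      using that by (intro sum.mono_neutral_left) (auto simp: coeff_eq_0)
    finally show ?thesis .
  qed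
  have zero: "0\<^sub>v n \<in> E"
  proof -
    have "0 \<cdot>\<^sub>v v = 0\<^sub>v n"
      using v(1) E by (intro eq_vecI) auto
    then show ?thesis
      using smult[OF v(1), of 0] by simp
  qed
  have partial: "vec n (\<lambda>i. \<Sum>j\<in>J. c j * g j $ i) \<in> E" if "finite J" for c J
    using that
  proof induction
    case empty
    have "vec n (\<lambda>i. \<Sum>j\<in>{}. c j * g j $ i) = 0\<^sub>v n" by auto
    then show ?case using zero by simp
  next
    case (insert x J)
    have "vec n (\<lambda>i. \<Sum>j\<in>insert x J. c j * g j $ i) =
        c x \<cdot>\<^sub>v g x + vec n (\<lambda>i. \<Sum>j\<in>J. c j * g j $ i)"
      using insert.hyps by (intro eq_vecI) auto
    then show ?case
      using add[OF smult[OF gE] insert.IH] by simp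
  qed
  have actE: "act p \<in> E" for p
    unfolding act_def by (rule partial) simp
  have act_pCons: "act (pCons 0 q) = A *\<^sub>v act q" for q
  proof (rule eq_vecI)
    fix i assume "i < dim_vec (A *\<^sub>v act q)"
    then have i: "i < n" using A by simp
    have "act (pCons 0 q) $ i = (\<Sum>j\<le>Suc (Polynomial.degree q). poly.coeff (pCons 0 q) j * g j $ i)"
      by (rule act_index) (use i in auto)
    also have "\<dots> = (\<Sum>j\<le>Polynomial.degree q. poly.coeff q j * g (Suc j) $ i)"
      by (subst sum.atMost_Suc_shift) simp
    also have "\<dots> = (\<Sum>j\<le>Polynomial.degree q. poly.coeff q j * (\<Sum>t<n. A $$ (i, t) * g j $ t))"
      using i A by (simp add: g_Suc scalar_prod_def atLeast0LessThan)
    also have "\<dots> = (\<Sum>t<n. A $$ (i, t) * (\<Sum>j\<le>Polynomial.degree q. poly.coeff q j * g j $ t))"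
      unfolding sum_distrib_left by (subst sum.swap) (simp add: mult.left_commute)
    also have "\<dots> = (A *\<^sub>v act q) $ i"
      using i A by (simp add: act_def scalar_prod_def atLeast0LessThan)
    finally show "act (pCons 0 q) $ i = (A *\<^sub>v act q) $ i" .
  qed (use A in \<open>simp add: act_def\<close>)
  have "\<exists>p. p \<noteq> 0 \<and> act p = 0\<^sub>v n"
  proof -
    \<comment> \<open>The columns are the n + 1 vectors \<open>g 0\<close>, ..., \<open>g n\<close>
      of length n, with a row of zeros added to make the matrix square. A kernel vector supplies the
      coefficients of an annihilating polynomial.\<close>
    define M where "M = mat (Suc n) (Suc n) (\<lambda>(i, j). if i < n then g j $ i else 0)"
    have M: "M \<in> carrier_mat (Suc n) (Suc n)"
      by (simp add: M_def)
    have "det M = 0"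
      using laplace_expansion_row[OF M, of n] by (simp add: M_def)
    then obtain x where x: "x \<in> carrier_vec (Suc n)" "x \<noteq> 0\<^sub>v (Suc n)" "M *\<^sub>v x = 0\<^sub>v (Suc n)"
      using det_0_iff_vec_prod_zero_field[OF M] by blast
    define p where "p = (\<Sum>j\<le>n. Polynomial.monom (x $ j) j)"
    have coeff_p: "poly.coeff p j = (if j \<le> n then x $ j else 0)" for j
      by (simp add: p_def coeff_sum)
    have "Polynomial.degree p \<le> n"
      by (intro degree_le) (simp add: coeff_p)
    have "p \<noteq> 0"
    proof
      assume "p = 0"
      then have "x $ j = 0" if "j \<le> n" for j
        using coeff_p[of j] that by simp
      then have "x = 0\<^sub>v (Suc n)"
        using x(1) by (intro eq_vecI) (auto simp: less_Suc_eq_le)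
      with x(2) show False by simp
    qed
    moreover have "act p = 0\<^sub>v n"
    proof (rule eq_vecI)
      fix i assume "i < dim_vec (0\<^sub>v n :: 'a vec)"
      then have i: "i < n" by simp
      have "act p $ i = (\<Sum>j\<le>n. poly.coeff p j * g j $ i)"
        using \<open>Polynomial.degree p \<le> n\<close> i by (rule act_index)
      also have "\<dots> = (M *\<^sub>v x) $ i"
        using i x(1) unfolding coeff_p
        by (simp add: M_def scalar_prod_def atLeast0LessThan lessThan_Suc_atMost mult.commute del: sum.lessThan_Suc sum.atMost_Suc)
      finally show "act p $ i = 0\<^sub>v n $ i"
        using i x(3) by simp
    qed (simp add: act_def)
    ultimately show ?thesis by blast
  qed
  then obtain p where p: "p \<noteq> 0" "act p = 0\<^sub>v n"
    and min: "\<And>q. q \<noteq> 0 \<Longrightarrow> act q = 0\<^sub>v n \<Longrightarrow> Polynomial.degree p \<le> Polynomial.degree q"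
    using ex_has_least_nat[of "\<lambda>p. p \<noteq> 0 \<and> act p = 0\<^sub>v n" _ Polynomial.degree] by blast
  have "Polynomial.degree p > 0"
  proof (rule ccontr)
    assume "\<not> Polynomial.degree p > 0"
    then obtain c where c: "p = [:c:]"
      by (auto elim: degree_eq_zeroE)
    have "dim_vec v = n"
      using v(1) E by auto
    then have "act p = c \<cdot>\<^sub>v v"
      by (intro eq_vecI) (auto simp: act_def c g_def)
    then have "v = inverse c \<cdot>\<^sub>v act p"
      using p(1) c by (simp add: smult_smult_assoc)
    then show False
      using v(2) p(2) by (auto simp: smult_vec_def)
  qed
  then obtain r where "poly p r = 0"
    using alg_closed_imp_poly_has_root by blast
  then obtain q where q: "p = [:- r, 1:] * q"
    using poly_eq_0_iff_dvd by blast
  with p(1) have "q \<noteq> 0" by auto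
  then have "Polynomial.degree q < Polynomial.degree p"
    unfolding q by (subst degree_mult_eq) auto
  then have "act q \<noteq> 0\<^sub>v n"
    using min[OF \<open>q \<noteq> 0\<close>] by auto
  moreover have "A *\<^sub>v act q = r \<cdot>\<^sub>v act q"
  proof (rule eq_vecI)
    fix i assume "i < dim_vec (r \<cdot>\<^sub>v act q)"
    then have i: "i < n" by (simp add: act_def)
    define N where "N = Suc (Polynomial.degree q)"
    have "Polynomial.degree p \<le> N" "Polynomial.degree (pCons 0 q) \<le> N" "Polynomial.degree q \<le> N"
      unfolding q N_def by (auto intro!: degree_diff_le order.trans[OF degree_smult_le])
    \<comment> \<open>This is \<open>p = X q - r q\<close> applied to \<open>v\<close>; its left
      side is zero, and \<open>act_pCons\<close> turns the first term on the right into
      \<open>A\<close> times \<open>act q\<close>.\<close>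
    then have "act p $ i = act (pCons 0 q) $ i - r * act q $ i"
      using i by (simp add: act_index[of _ N] q sum_distrib_left algebra_simps
          flip: sum_subtractf sum.distrib)
    then show "(A *\<^sub>v act q) $ i = (r \<cdot>\<^sub>v act q) $ i"
      using i p(2) by (simp add: act_pCons) (simp add: act_def)
  qed (use A in \<open>simp add: act_def\<close>)
  ultimately show ?thesis
    using actE by blast
qed

text \<open>By induction the earlier matrices share an eigenvector. Their joint eigenspace for its
  eigenvalues is invariant under the new matrix, which commutes with them, and so contains an
  eigenvector of that matrix.\<close>

lemma exists_common_eigenvector:
  fixes \<A> :: "'a::alg_closed_field mat set"
  assumes "finite \<A>" "\<A> \<subseteq> carrier_mat n n" "n > 0"
    and "\<And>A B. A \<in> \<A> \<Longrightarrow> B \<in> \<A> \<Longrightarrow> A * B = B * A"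
  shows "\<exists>v\<in>carrier_vec n. v \<noteq> 0\<^sub>v n \<and> (\<forall>A\<in>\<A>. \<exists>c. A *\<^sub>v v = c \<cdot>\<^sub>v v)"
  using assms
proof (induction rule: finite_induct)
  case empty
  have "unit_vec n 0 \<noteq> (0\<^sub>v n :: 'a vec)"
    using empty by (simp add: unit_vec_nonzero)
  then show ?case by (intro bexI[of _ "unit_vec n 0"]) auto
next
  case (insert B \<A>)
  then obtain v where v: "v \<in> carrier_vec n" "v \<noteq> 0\<^sub>v n" "\<forall>A\<in>\<A>. \<exists>c. A *\<^sub>v v = c \<cdot>\<^sub>v v"
    by auto
  then obtain e where e: "A *\<^sub>v v = e A \<cdot>\<^sub>v v" if "A \<in> \<A>" for A
    by metis
  define E where "E = {w \<in> carrier_vec n. \<forall>A\<in>\<A>. A *\<^sub>v w = e A \<cdot>\<^sub>v w}"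
  have B: "B \<in> carrier_mat n n"
    using insert.prems by auto
  have "\<exists>w\<in>E. w \<noteq> 0\<^sub>v n \<and> (\<exists>c. B *\<^sub>v w = c \<cdot>\<^sub>v w)"
  proof (rule exists_eigenvector_in_invariant_subspace[OF B])
    show "v \<in> E" "v \<noteq> 0\<^sub>v n"
      using v e by (auto simp: E_def)
    show "E \<subseteq> carrier_vec n"
      by (auto simp: E_def)
    fix u w assume u: "u \<in> E" and w: "w \<in> E"
    show "u + w \<in> E"
      using u w insert.prems(1)
      by (auto simp: E_def mult_add_distrib_mat_vec[of _ n n] smult_add_distrib_vec[of _ n])
  next
    fix c w assume w: "w \<in> E"
    show "c \<cdot>\<^sub>v w \<in> E"
      using w insert.prems(1)
      by (auto simp: E_def mult_mat_vec[of _ n n] smult_smult_assoc mult.commute)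
  next
    fix w assume w: "w \<in> E"
    have "A *\<^sub>v (B *\<^sub>v w) = e A \<cdot>\<^sub>v (B *\<^sub>v w)" if "A \<in> \<A>" for A
    proof -
      have A: "A \<in> carrier_mat n n"
        using that insert.prems(1) by auto
      have w': "w \<in> carrier_vec n" "A *\<^sub>v w = e A \<cdot>\<^sub>v w"
        using w that by (auto simp: E_def)
      have "A *\<^sub>v (B *\<^sub>v w) = (A * B) *\<^sub>v w"
        using A B w' by simp
      also have "A * B = B * A"
        using insert.prems(3) that by auto
      also have "(B * A) *\<^sub>v w = B *\<^sub>v (A *\<^sub>v w)"
        using A B w' by simp
      also have "\<dots> = e A \<cdot>\<^sub>v (B *\<^sub>v w)"
        using B w' by (simp add: mult_mat_vec[of _ n n])
      finally show ?thesis .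
    qed
    then show "B *\<^sub>v w \<in> E"
      using w B by (auto simp: E_def)
  qed
  then show ?case
    by (auto simp: E_def)
qed

text \<open>If the first entry of \<open>v\<close> is nonzero, the identity matrix with first column
  replaced by \<open>v\<close> is lower triangular with nonzero diagonal. Otherwise a row exchange
  reduces to this case.\<close>

lemma exists_invertible_mat_with_first_col:
  fixes v :: "'a::field vec"
  assumes v: "v \<in> carrier_vec (Suc n)" "v \<noteq> 0\<^sub>v (Suc n)"
  obtains P where "P \<in> carrier_mat (Suc n) (Suc n)" "det P \<noteq> 0" "col P 0 = v"
proof -
  define P0 where "P0 u = mat (Suc n) (Suc n) (\<lambda>(i, j). if j = 0 then u $ i else if i = j then 1 else 0)"
    for u :: "'a vec"
  have P0: "P0 u \<in> carrier_mat (Suc n) (Suc n)" for u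
    by (simp add: P0_def)
  have det_P0: "det (P0 u) \<noteq> 0" if "u $ 0 \<noteq> 0" for u :: "'a vec"
  proof -
    have "det (P0 u) = prod_list (diag_mat (P0 u))"
      by (rule det_lower_triangular[OF _ P0]) (auto simp: P0_def)
    then show ?thesis
      using that by (auto simp: prod_list_zero_iff diag_mat_def P0_def split: if_splits)
  qed
  obtain k where k: "k < Suc n" "v $ k \<noteq> 0"
    using v by (metis carrier_vecD eq_vecI index_zero_vec)
  show thesis
  proof (cases "v $ 0 = 0")
    case False
    show thesis
      by (rule that[OF P0 det_P0[OF False]]) (use v in \<open>auto intro!: eq_vecI simp: P0_def\<close>)
  next
    case True
    \<comment> \<open>\<open>u\<close> is \<open>v\<close> with entries 0 and \<open>k\<close>
      exchanged; exchanging rows 0 and \<open>k\<close> of \<open>P0 u\<close> restores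
      \<open>v\<close> as first column.\<close>
    define u where "u = vec (Suc n) (\<lambda>i. if i = 0 then v $ k else if i = k then v $ 0 else v $ i)"
    define P where "P = swaprows 0 k (P0 u)"
    have "k \<noteq> 0" using k True by metis
    have "det P = - det (P0 u)"
      unfolding P_def using \<open>k \<noteq> 0\<close> k by (intro det_swaprows[OF _ _ _ P0]) auto
    moreover have "det (P0 u) \<noteq> 0"
      using k by (intro det_P0) (simp add: u_def)
    moreover have "col P 0 = v"
      using v k by (intro eq_vecI) (auto simp: P_def P0_def u_def)
    ultimately show thesis
      by (intro that[of P]) (auto simp: P_def P0_def)
  qed
qed

text \<open>A base change whose first column is a common eigenvector clears the first columns below
  the diagonal. The lower right blocks commute again, so induction triangularizes them.\<close>

lemma simultaneous_triangularization:
  fixes A :: "'i \<Rightarrow> 'a::alg_closed_field mat"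
  assumes "finite I" "\<And>i. i \<in> I \<Longrightarrow> A i \<in> carrier_mat n n"
    and "\<And>i j. i \<in> I \<Longrightarrow> j \<in> I \<Longrightarrow> A i * A j = A j * A i"
  shows "\<exists>P Q. P \<in> carrier_mat n n \<and> Q \<in> carrier_mat n n \<and> P * Q = 1\<^sub>m n \<and> Q * P = 1\<^sub>m n \<and>
    (\<forall>i\<in>I. upper_triangular (Q * A i * P))"
  using assms(2,3)
proof (induction n arbitrary: A)
  case 0
  show ?case
    by (intro exI[of _ "1\<^sub>m 0"]) (auto simp: upper_triangular_def)
next
  case (Suc n)
  note assoc = assoc_mult_mat[of _ "Suc n" "Suc n" _ "Suc n" _ "Suc n"]
    mult_carrier_mat[of _ "Suc n" "Suc n" _ "Suc n"] left_mult_one_mat[of _ "Suc n" "Suc n"]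
  have A: "A i \<in> carrier_mat (Suc n) (Suc n)" if "i \<in> I" for i
    by (rule Suc.prems) (rule that)
  have "\<exists>v\<in>carrier_vec (Suc n). v \<noteq> 0\<^sub>v (Suc n) \<and> (\<forall>B\<in>A ` I. \<exists>c. B *\<^sub>v v = c \<cdot>\<^sub>v v)"
    by (rule exists_common_eigenvector) (use assms(1) A Suc.prems(2) in auto)
  then obtain v where v: "v \<in> carrier_vec (Suc n)" "v \<noteq> 0\<^sub>v (Suc n)"
    and "\<forall>i\<in>I. \<exists>c. A i *\<^sub>v v = c \<cdot>\<^sub>v v"
    by blast
  then obtain e where e: "A i *\<^sub>v v = e i \<cdot>\<^sub>v v" if "i \<in> I" for i
    by metis
  obtain P where P: "P \<in> carrier_mat (Suc n) (Suc n)" "det P \<noteq> 0" "col P 0 = v"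
    using exists_invertible_mat_with_first_col[OF v] .
  obtain Q where Q: "Q \<in> carrier_mat (Suc n) (Suc n)" "P * Q = 1\<^sub>m (Suc n)" "Q * P = 1\<^sub>m (Suc n)"
    using invertible_mat_inverse[OF P(1,2)] .
  define B where "B i = Q * A i * P" for i
  define C where "C i = mat n n (\<lambda>(r, s). B i $$ (Suc r, Suc s))" for i
  define R where "R i = mat 1 n (\<lambda>(r, s). B i $$ (0, Suc s))" for i
  have B: "B i \<in> carrier_mat (Suc n) (Suc n)" if "i \<in> I" for i
    using A[OF that] P Q by (simp add: B_def)
  have B_mult: "B i * B j = Q * (A i * A j) * P" if "i \<in> I" "j \<in> I" for i j
  proof -
    note [simp] = A[OF that(1)] A[OF that(2)] P(1) Q(1)
    have "B i * B j = Q * A i * (P * Q) * (A j * P)"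
      by (simp add: B_def assoc)
    also have "\<dots> = Q * (A i * A j) * P"
      unfolding Q(2) by (simp add: assoc)
    finally show ?thesis .
  qed
  \<comment> \<open>The first column of \<open>B i\<close> is \<open>e i\<close> times the first
    unit vector.\<close>
  have B_col: "B i $$ (Suc r, 0) = 0" if "i \<in> I" "r < n" for i r
  proof -
    have "B i $$ (Suc r, 0) = col (B i) 0 $ Suc r"
      using B[OF that(1)] that(2) by simp
    also have "col (B i) 0 = (Q * A i) *\<^sub>v v"
      unfolding B_def P(3)[symmetric] using A[OF that(1)] P(1) Q(1)
      by (intro col_mult2[of _ "Suc n" "Suc n" _ "Suc n"]) (simp_all add: assoc)
    also have "\<dots> = e i \<cdot>\<^sub>v (Q *\<^sub>v col P 0)"
      using A[OF that(1)] Q(1) v(1) P(3) e[OF that(1)] by (simp add: mult_mat_vec[of _ "Suc n" "Suc n"])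
    also have "Q *\<^sub>v col P 0 = col (1\<^sub>m (Suc n)) 0"
      using Q(1,3) P(1) by (metis col_mult2 zero_less_Suc)
    finally show ?thesis
      using that by simp
  qed
  have B_block: "B i = four_block_mat (mat 1 1 (\<lambda>_. B i $$ (0, 0))) (R i) (0\<^sub>m n 1) (C i)" if "i \<in> I" for i
    using B[OF that] B_col[OF that] by (intro eq_matI) (auto simp: C_def R_def less_Suc_eq_0_disj)
  have C: "C i \<in> carrier_mat n n" for i
    by (simp add: C_def)
  have C_dim [simp]: "dim_row (C i) = n" "dim_col (C i) = n" for i
    by (simp_all add: C_def)
  \<comment> \<open>The term through index 0 vanishes by \<open>B_col\<close>, so the blocks
    \<open>C i\<close> inherit commutativity from the \<open>B i\<close>.\<close>
  have C_mult: "(C i * C j) $$ (r, s) = (B i * B j) $$ (Suc r, Suc s)"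
    if "i \<in> I" "j \<in> I" "r < n" "s < n" for i j r s
    using B[OF that(1)] B[OF that(2)] B_col[OF that(1,3)] that(3,4)
    by (simp add: C_def scalar_prod_def sum.atLeast0_lessThan_Suc_shift del: sum.op_ivl_Suc)
  have "C i * C j = C j * C i" if "i \<in> I" "j \<in> I" for i j
    using that by (intro eq_matI) (simp_all add: C_mult B_mult Suc.prems(2)[OF that]
        del: index_mult_mat(1))
  then obtain P' Q' where P': "P' \<in> carrier_mat n n" and Q': "Q' \<in> carrier_mat n n"
    and PQ': "P' * Q' = 1\<^sub>m n" "Q' * P' = 1\<^sub>m n"
    and upper: "\<And>i. i \<in> I \<Longrightarrow> upper_triangular (Q' * C i * P')"
    using Suc.IH[of C] C by metis
  \<comment> \<open>\<open>S M\<close> is block diagonal with blocks 1 and \<open>M\<close>; it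
    extends the smaller base change to size \<open>Suc n\<close>.\<close>
  define S where "S M = four_block_mat (1\<^sub>m 1) (0\<^sub>m 1 n) (0\<^sub>m n 1) M" for M :: "'a mat"
  have S: "S M \<in> carrier_mat (Suc n) (Suc n)" if "M \<in> carrier_mat n n" for M
    using four_block_carrier_mat[OF one_carrier_mat[of 1] that] by (simp add: S_def)
  have S_mult: "S M * S N = S (M * N)" if "M \<in> carrier_mat n n" "N \<in> carrier_mat n n" for M N
    unfolding S_def using that
    by (subst mult_four_block_mat[of _ 1 1 _ n _ n _ _ 1 _ n]) auto
  have S_one: "S (1\<^sub>m n) = 1\<^sub>m (Suc n)"
    by (simp add: S_def)
  note SP = S[OF P'] and SQ = S[OF Q']
  have "upper_triangular (S Q' * Q * A i * (P * S P'))" if "i \<in> I" for i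
  proof -
    note [simp] = A[OF that] P(1) Q(1) SP SQ P' Q' C
    have "S Q' * Q * A i * (P * S P') = S Q' * B i * S P'"
      by (simp add: B_def assoc)
    also have "S Q' * B i = four_block_mat (mat 1 1 (\<lambda>_. B i $$ (0, 0))) (R i) (0\<^sub>m n 1) (Q' * C i)"
      by (subst B_block[OF that], unfold S_def, subst mult_four_block_mat[of _ 1 1 _ n _ n _ _ 1 _ n])
        (auto simp: R_def right_mult_zero_mat[OF Q'] left_add_zero_mat[OF mult_carrier_mat[OF Q' C]])
    also have "\<dots> * S P' = four_block_mat (mat 1 1 (\<lambda>_. B i $$ (0, 0))) (R i * P') (0\<^sub>m n 1) (Q' * C i * P')"
    proof -
      have QC: "Q' * C i \<in> carrier_mat n n" and R: "R i \<in> carrier_mat 1 n"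
        by (rule mult_carrier_mat[OF Q' C]) (simp add: R_def)
      have "Q' * C i * P' \<in> carrier_mat n n" "R i * P' \<in> carrier_mat 1 n"
        by (rule mult_carrier_mat[OF QC P'], rule mult_carrier_mat[OF R P'])
      then show ?thesis
        unfolding S_def using QC R
        by (subst mult_four_block_mat[of _ 1 1 _ n _ n _ _ 1 _ n])
          (simp_all add: right_mult_zero_mat[OF QC] right_mult_zero_mat[OF R])
    qed
    finally show ?thesis
      using upper_triangular_four_block[OF _ mult_carrier_mat[OF mult_carrier_mat[OF Q' C] P'] _ upper[OF that],
          of "mat 1 1 (\<lambda>_. B i $$ (0, 0))" 1 "R i * P'"]
      by (simp add: upper_triangular_def)
  qed
  moreover have "(P * S P') * (S Q' * Q) = P * (S P' * S Q') * Q"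
    using P(1) Q(1) SP SQ by (simp add: assoc)
  then have "(P * S P') * (S Q' * Q) = 1\<^sub>m (Suc n)"
    using P Q by (simp add: S_mult P' Q' PQ' S_one)
  moreover have "(S Q' * Q) * (P * S P') = S Q' * (Q * P) * S P'"
    using P(1) Q(1) SP SQ by (simp add: assoc)
  then have "(S Q' * Q) * (P * S P') = 1\<^sub>m (Suc n)"
    using SQ by (simp add: Q(3) S_mult P' Q' PQ' S_one)
  ultimately show ?case
    using P(1) Q(1) SP SQ by (intro exI[of _ "P * S P'"] exI[of _ "S Q' * Q"]) auto
qed

section \<open>The regular representation of a finite extension\<close>

lemma block_mat_one:
  "block_mat n d (\<lambda>i j k l. (1\<^sub>m n $$ (i, j)) * (if k = l then 1 else 0)) = (1\<^sub>m (n * d) :: 'a::semiring_1 mat)"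
proof (rule eq_matI)
  fix r s
  assume "r < dim_row (1\<^sub>m (n * d) :: 'a mat)" "s < dim_col (1\<^sub>m (n * d) :: 'a mat)"
  then have "r < n * d" "s < n * d" by simp_all
  moreover have "r div d = s div d \<and> r mod d = s mod d \<longleftrightarrow> r = s"
    by (metis div_mult_mod_eq)
  ultimately show "block_mat n d (\<lambda>i j k l. (1\<^sub>m n $$ (i, j)) * (if k = l then 1 else 0)) $$ (r, s) =
      (1\<^sub>m (n * d) :: 'a mat) $$ (r, s)"
    using block_index[of r n d] block_index[of s n d] by (auto simp: block_mat_def)
qed (simp_all add: block_mat_def)

text \<open>The outer factors are the Kronecker products of \<open>Q\<close> and \<open>P\<close>
  with the d by d identity. They mix block indices only, so the inner sums collapse.\<close>

lemma block_mat_conjugate: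
  fixes P Q :: "'a::comm_semiring_1 mat"
  shows "block_mat n d (\<lambda>i j k l. Q $$ (i, j) * (if k = l then 1 else 0)) * block_mat n d G *
      block_mat n d (\<lambda>i j k l. P $$ (i, j) * (if k = l then 1 else 0)) =
    block_mat n d (\<lambda>i j k l. \<Sum>t<n. \<Sum>u<n. Q $$ (i, u) * G u t k l * P $$ (t, j))"
  unfolding block_mat_mult
proof (rule block_mat_cong)
  fix i j k l assume "k < d" "l < d"
  have "(\<Sum>u<d. Q $$ (i, t) * (if k = u then 1 else 0) * G t j' u l') = Q $$ (i, t) * G t j' k l'" for t j' l'
  proof -
    have "(\<Sum>u<d. Q $$ (i, t) * (if k = u then 1 else 0) * G t j' u l') =
        (\<Sum>u<d. if k = u then Q $$ (i, t) * G t j' k l' else 0)"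
      by (rule sum.cong) auto
    then show ?thesis using \<open>k < d\<close> by simp
  qed
  then have "(\<Sum>t<n. \<Sum>u<d. (\<Sum>t'<n. \<Sum>u'<d. Q $$ (i, t') * (if k = u' then 1 else 0) * G t' t u' u) *
        (P $$ (t, j) * (if u = l then 1 else 0))) =
      (\<Sum>t<n. \<Sum>u<d. if u = l then (\<Sum>t'<n. Q $$ (i, t') * G t' t k l) * P $$ (t, j) else 0)"
    by (intro sum.cong) auto
  also have "\<dots> = (\<Sum>t<n. \<Sum>u<n. Q $$ (i, u) * G u t k l * P $$ (t, j))"
    using \<open>l < d\<close> by (simp add: sum_distrib_right)
  finally show "(\<Sum>t<n. \<Sum>u<d. (\<Sum>t'<n. \<Sum>u'<d. Q $$ (i, t') * (if k = u' then 1 else 0) * G t' t u' u) *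
        (P $$ (t, j) * (if u = l then 1 else 0))) =
      (\<Sum>t<n. \<Sum>u<n. Q $$ (i, u) * G u t k l * P $$ (t, j))" .
qed

text \<open>The two Kronecker products multiply to that of \<open>Q * P\<close>, which is the
  identity, so their determinants cancel.\<close>

lemma det_block_mat_conjugate:
  fixes P Q :: "'a::comm_ring_1 mat"
  assumes "P \<in> carrier_mat n n" "Q \<in> carrier_mat n n" "Q * P = 1\<^sub>m n"
  shows "det (block_mat n d (\<lambda>i j k l. \<Sum>t<n. \<Sum>u<n. Q $$ (i, u) * G u t k l * P $$ (t, j))) =
    det (block_mat n d G)"
proof -
  let ?K = "\<lambda>M. block_mat n d (\<lambda>i j k l. M $$ (i, j) * (if k = l then 1 else 0)) :: 'a mat"
  have "?K Q * ?K P = block_mat n d (\<lambda>i j k l. (1\<^sub>m n $$ (i, j)) * (if k = l then 1 else 0))"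
    unfolding block_mat_mult
  proof (rule block_mat_cong)
    fix i j k l assume ij: "i < n" "j < n" and kl: "k < d" "l < d"
    have "(\<Sum>t<n. \<Sum>u<d. Q $$ (i, t) * (if k = u then 1 else 0) * (P $$ (t, j) * (if u = l then 1 else 0))) =
        (\<Sum>t<n. \<Sum>u<d. if u = k then Q $$ (i, t) * P $$ (t, j) * (if k = l then 1 else 0) else 0)"
      by (intro sum.cong) auto
    also have "\<dots> = (\<Sum>t<n. Q $$ (i, t) * P $$ (t, j)) * (if k = l then 1 else 0)"
      using kl by (simp add: sum_distrib_right)
    also have "(\<Sum>t<n. Q $$ (i, t) * P $$ (t, j)) = (Q * P) $$ (i, j)"
      using assms(1,2) ij by (simp add: scalar_prod_def atLeast0LessThan)
    finally show "(\<Sum>t<n. \<Sum>u<d. Q $$ (i, t) * (if k = u then 1 else 0) * (P $$ (t, j) * (if u = l then 1 else 0))) =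
        1\<^sub>m n $$ (i, j) * (if k = l then 1 else 0)"
      by (simp only: assms(3))
  qed
  then have "det (?K Q) * det (?K P) = 1"
    using det_mult[of "?K Q" "n * d" "?K P"] by (simp only: block_mat_one block_mat_carrier det_one)
  moreover have "det (?K Q * block_mat n d G * ?K P) = det (?K Q) * det (block_mat n d G) * det (?K P)"
    by (simp add: det_mult[of _ "n * d"] mult_carrier_mat[of _ "n * d" "n * d" _ "n * d"])
  ultimately show ?thesis
    unfolding block_mat_conjugate by (simp add: mult.commute mult.left_commute)
qed

section \<open>Multiplication in a finite extension in coordinates of an ordered basis\<close>

locale extension_basis =
  fixes h :: "'f::field \<Rightarrow> 'k::field" and bs :: "'k list"
  assumes hom: "field_hom h"
    and distinct: "distinct bs"
    and basis: "is_basis (ext_scale h) (set bs)"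
begin

sublocale h: field_hom h
  by (rule hom)

sublocale K: vector_space "ext_scale h"
  by unfold_locales (simp_all add: ext_scale_def algebra_simps h.hom_add h.hom_mult)

abbreviation "n \<equiv> length bs"

abbreviation "coord x i \<equiv> K.representation (set bs) x (bs ! i)"

lemma independent: "K.independent (set bs)" and span: "K.span (set bs) = UNIV"
  using basis by (simp_all add: is_basis_def)

lemma coord_add: "coord (x + y) i = coord x i + coord y i"
  by (simp add: K.representation_add independent span)

lemma coord_scale: "coord (h c * x) i = c * coord x i"
  using K.representation_scale[OF independent, of x c] by (simp add: span ext_scale_def)

lemma coord_sum: "coord (\<Sum>j\<in>J. f j) i = (\<Sum>j\<in>J. coord (f j) i)"
  using K.representation_sum[OF independent, of J f] by (simp add: span)

lemma coord_basis: "i < n \<Longrightarrow> j < n \<Longrightarrow> coord (bs ! j) i = (if i = j then 1 else 0)"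
  using distinct by (simp add: K.representation_basis[OF independent] nth_eq_iff_index_eq)

lemma expansion: "(\<Sum>i<n. h (coord x i) * bs ! i) = x"
proof -
  have "(\<Sum>i<n. h (coord x i) * bs ! i) = (\<Sum>b\<in>set bs. ext_scale h (K.representation (set bs) x b) b)"
    unfolding ext_scale_def
    by (rule sum.reindex_bij_betw[OF bij_betw_nth]) (simp_all add: distinct lessThan_def)
  also have "\<dots> = x"
    by (rule K.sum_representation_eq) (simp_all add: independent span)
  finally show ?thesis .
qed

text \<open>The matrix of multiplication by \<open>x\<close>, with the images of the basis elements
  as columns, as in \<open>field_norm\<close>.\<close>

definition reg :: "'k \<Rightarrow> nat \<Rightarrow> nat \<Rightarrow> 'f" where
  "reg x i j = coord (x * bs ! j) i"

lemma reg_add: "reg (x + y) i j = reg x i j + reg y i j"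
  by (simp add: reg_def distrib_right coord_add)

lemma reg_scale: "reg (h c * x) i j = c * reg x i j"
  by (simp add: reg_def mult.assoc coord_scale)

lemma reg_one: "i < n \<Longrightarrow> j < n \<Longrightarrow> reg 1 i j = (if i = j then 1 else 0)"
  by (simp add: reg_def coord_basis)

lemma reg_mult: "reg (x * y) i j = (\<Sum>t<n. reg x i t * reg y t j)"
proof -
  have "x * y * bs ! j = x * (\<Sum>t<n. h (reg y t j) * bs ! t)"
    by (simp add: reg_def expansion mult.assoc)
  also have "\<dots> = (\<Sum>t<n. h (reg y t j) * (x * bs ! t))"
    by (simp add: sum_distrib_left mult.left_commute)
  finally have "reg (x * y) i j = (\<Sum>t<n. reg y t j * reg x i t)"
    by (simp add: reg_def[of "x * y"] coord_sum coord_scale) (simp add: reg_def[of x])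
  then show ?thesis
    by (simp add: mult.commute)
qed

text \<open>The entries are moved to the algebraic closure, where eigenvectors exist.\<close>

definition reg_mat :: "'k \<Rightarrow> 'f alg_closure mat" where
  "reg_mat x = mat n n (\<lambda>(i, j). to_ac (reg x i j))"

lemma reg_mat_carrier [simp]: "reg_mat x \<in> carrier_mat n n"
  by (simp add: reg_mat_def)

lemma reg_mat_mult: "reg_mat (x * y) = reg_mat x * reg_mat y"
  by (rule eq_matI)
    (simp_all add: reg_mat_def reg_mult scalar_prod_def atLeast0LessThan to_ac_sum)

lemma reg_mat_one: "reg_mat 1 = 1\<^sub>m n"
  by (rule eq_matI) (auto simp: reg_mat_def reg_one)

lemma reg_mat_add: "reg_mat (x + y) = reg_mat x + reg_mat y"
  by (rule eq_matI) (auto simp: reg_mat_def reg_add)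

lemma reg_mat_scale: "reg_mat (h c * x) = to_ac c \<cdot>\<^sub>m reg_mat x"
  by (rule eq_matI) (auto simp: reg_mat_def reg_scale)

text \<open>The basis gives a finite commuting family. A base change that triangularizes it works
  for every \<open>x\<close>, since \<open>reg_mat\<close> is linear over F and upper triangular
  matrices form a subspace.\<close>

lemma reg_mat_triangularization:
  obtains P Q where "P \<in> carrier_mat n n" "Q \<in> carrier_mat n n" "P * Q = 1\<^sub>m n" "Q * P = 1\<^sub>m n"
    "\<And>x. upper_triangular (Q * reg_mat x * P)"
proof -
  have "reg_mat x * reg_mat y = reg_mat y * reg_mat x" for x y
    by (simp add: mult.commute flip: reg_mat_mult)
  then obtain P Q where PQ: "P \<in> carrier_mat n n" "Q \<in> carrier_mat n n" "P * Q = 1\<^sub>m n" "Q * P = 1\<^sub>m n"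
    and basis: "\<forall>b\<in>set bs. upper_triangular (Q * reg_mat b * P)"
    using simultaneous_triangularization[of "set bs" reg_mat n] by auto
  have "upper_triangular (Q * reg_mat x * P)" for x
  proof -
    have "x \<in> K.span (set bs)"
      by (simp add: span)
    then show ?thesis
    proof (induction rule: K.span_induct_alt)
      case base
      have "reg_mat 0 = 0\<^sub>m n n"
        using reg_scale[of 0 0] by (intro eq_matI) (simp_all add: reg_mat_def)
      then show ?case
        using PQ by simp
    next
      case (step c b y)
      have "Q * reg_mat (ext_scale h c b + y) * P = to_ac c \<cdot>\<^sub>m (Q * reg_mat b * P) + Q * reg_mat y * P"
        using PQ
        by (simp add: ext_scale_def reg_mat_add reg_mat_scale mult_add_distrib_mat[of _ n n _ n]
            add_mult_distrib_mat[of _ n n _ _ n] mult_smult_distrib[of _ n n _ n] mult_smult_assoc_mat[of _ n n _ n]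
            mult_carrier_mat[of _ n n _ n])
      then show ?case
        using step basis PQ by (auto simp: upper_triangular_def)
    qed
  qed
  with PQ show thesis
    using that by blast
qed

text \<open>
  The diagonal entries of a simultaneous triangularization are homomorphisms from \<open>K\<close> to the
  algebraic closure of \<open>F\<close>; they compute both the field norm and the block determinants.
\<close>

lemma exists_diagonal_homs:
  obtains \<chi> :: "nat \<Rightarrow> 'k \<Rightarrow> 'f alg_closure"
  where "\<forall>i<n. field_hom (\<chi> i) \<and> (\<forall>c. \<chi> i (h c) = to_ac c)"
    "\<forall>x. det (reg_mat x) = (\<Prod>i<n. \<chi> i x)"
    "\<forall>(B :: 'b set) d y w.
      det (block_mat n d (\<lambda>i j k l. \<Sum>b\<in>B. to_ac (reg (y b) i j) * w b k l)) =
      (\<Prod>i<n. det (mat d d (\<lambda>(k, l). \<Sum>b\<in>B. \<chi> i (y b) * w b k l)))"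
proof -
  obtain P Q where P: "P \<in> carrier_mat n n" and Q: "Q \<in> carrier_mat n n"
    and PQ: "P * Q = 1\<^sub>m n" "Q * P = 1\<^sub>m n"
    and upper: "\<And>x. upper_triangular (Q * reg_mat x * P)"
    using reg_mat_triangularization by blast
  note closed = mult_carrier_mat[of _ n n _ n]
  define T where "T x = Q * reg_mat x * P" for x
  define \<chi> where "\<chi> i x = T x $$ (i, i)" for i x
  have T: "T x \<in> carrier_mat n n" for x
    using P Q by (simp add: T_def closed)
  have T_dim [simp]: "dim_row (T x) = n" "dim_col (T x) = n" for x
    using T[of x] by auto
  have T_upper: "T x $$ (i, j) = 0" if "j < i" "i < n" for x i j
    using upper[of x] that P Q by (auto simp: T_def upper_triangular_def)
  have T_add: "T (x + y) = T x + T y" for x y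
    using P Q by (simp add: T_def reg_mat_add mult_add_distrib_mat[of _ n n _ n]
        add_mult_distrib_mat[of _ n n _ _ n] closed)
  have T_scale: "T (h c * x) = to_ac c \<cdot>\<^sub>m T x" for c x
    using P Q by (simp add: T_def reg_mat_scale mult_smult_distrib[of _ n n _ n]
        mult_smult_assoc_mat[of _ n n _ n] closed)
  have T_one: "T 1 = 1\<^sub>m n"
    using Q by (simp add: T_def reg_mat_one PQ)
  have T_mult: "T (x * y) = T x * T y" for x y
  proof -
    have "T x * T y = Q * reg_mat x * (P * Q) * (reg_mat y * P)"
      using P Q by (simp add: T_def assoc_mult_mat[of _ n n _ n _ n] closed)
    also have "\<dots> = T (x * y)"
      unfolding PQ(1) using P Q
      by (simp add: T_def reg_mat_mult assoc_mult_mat[of _ n n _ n _ n] closed left_mult_one_mat[of _ n n])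
    finally show ?thesis by simp
  qed
  have hom: "field_hom (\<chi> i)" if "i < n" for i
  proof -
    have "\<chi> i (x * y) = \<chi> i x * \<chi> i y" for x y
    proof -
      have "\<chi> i (x * y) = (\<Sum>t<n. T x $$ (i, t) * T y $$ (t, i))"
        using that by (simp add: \<chi>_def T_mult scalar_prod_def atLeast0LessThan)
      \<comment> \<open>For \<open>t < i\<close> the first factor vanishes, for \<open>t > i\<close>
        the second.\<close>
      also have "\<dots> = (\<Sum>t<n. if t = i then \<chi> i x * \<chi> i y else 0)"
        using that T_upper by (intro sum.cong) (auto simp: \<chi>_def linorder_neq_iff)
      finally show ?thesis using that by simp
    qed
    moreover have "\<chi> i (x + y) = \<chi> i x + \<chi> i y" "\<chi> i 1 = 1" for x y
      using that by (simp_all add: \<chi>_def T_add T_one)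
    moreover from this(1)[of 0 0] have "\<chi> i 0 = 0"
      by (metis add_0 add_cancel_right_right)
    ultimately show ?thesis
      by unfold_locales
  qed
  have base: "\<chi> i (h c) = to_ac c" if "i < n" for i c
    using that T_scale[of c 1] by (simp add: \<chi>_def T_one)
  have det: "det (reg_mat x) = (\<Prod>i<n. \<chi> i x)" for x
  proof -
    have "det Q * det P = 1"
      using det_mult[OF Q P] by (simp add: PQ)
    then have "det (reg_mat x) = det (T x)"
      using P Q by (simp add: T_def det_mult[where n = n] closed mult.commute mult.left_commute)
    also have "\<dots> = prod_list (diag_mat (T x))"
      by (rule det_upper_triangular[OF _ T]) (use upper in \<open>simp add: T_def\<close>)
    also have "\<dots> = (\<Prod>i<n. \<chi> i x)"
      by (simp add: diag_mat_def \<chi>_def prod.list_conv_set_nth atLeast0LessThan)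
    finally show ?thesis .
  qed
  have T_index: "T x $$ (i, j) = (\<Sum>t<n. \<Sum>u<n. Q $$ (i, u) * to_ac (reg x u t) * P $$ (t, j))"
    if "i < n" "j < n" for x i j
    using that P Q
    by (simp add: T_def reg_mat_def scalar_prod_def atLeast0LessThan sum_distrib_right)
  have "det (block_mat n d (\<lambda>i j k l. \<Sum>b\<in>B. to_ac (reg (y b) i j) * w b k l)) =
      (\<Prod>i<n. det (mat d d (\<lambda>(k, l). \<Sum>b\<in>B. \<chi> i (y b) * w b k l)))" for B :: "'b set" and d y w
  proof -
    \<comment> \<open>Conjugation commutes with the sum over \<open>B\<close> and replaces each
      \<open>reg (y b)\<close> by the triangular \<open>T (y b)\<close>. The result is block upper
      triangular, and its diagonal blocks involve only the \<open>\<chi> i (y b)\<close>.\<close>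
    let ?G = "\<lambda>i j k l. \<Sum>b\<in>B. to_ac (reg (y b) i j) * w b k l"
    have "det (block_mat n d ?G) =
        det (block_mat n d (\<lambda>i j k l. \<Sum>t<n. \<Sum>u<n. Q $$ (i, u) * ?G u t k l * P $$ (t, j)))"
      by (rule det_block_mat_conjugate[symmetric, OF P Q PQ(2)])
    also have "block_mat n d (\<lambda>i j k l. \<Sum>t<n. \<Sum>u<n. Q $$ (i, u) * ?G u t k l * P $$ (t, j)) =
        block_mat n d (\<lambda>i j k l. \<Sum>b\<in>B. T (y b) $$ (i, j) * w b k l)"
    proof (rule block_mat_cong)
      fix i j k l assume ij: "i < n" "j < n"
      have "(\<Sum>t<n. \<Sum>u<n. Q $$ (i, u) * ?G u t k l * P $$ (t, j)) =
          (\<Sum>t<n. \<Sum>u<n. \<Sum>b\<in>B. Q $$ (i, u) * to_ac (reg (y b) u t) * P $$ (t, j) * w b k l)"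
        by (simp add: sum_distrib_left sum_distrib_right mult_ac)
      also have "\<dots> = (\<Sum>t<n. \<Sum>b\<in>B. \<Sum>u<n. Q $$ (i, u) * to_ac (reg (y b) u t) * P $$ (t, j) * w b k l)"
        by (rule sum.cong[OF refl], rule sum.swap)
      also have "\<dots> = (\<Sum>b\<in>B. \<Sum>t<n. \<Sum>u<n. Q $$ (i, u) * to_ac (reg (y b) u t) * P $$ (t, j) * w b k l)"
        by (rule sum.swap)
      also have "\<dots> = (\<Sum>b\<in>B. T (y b) $$ (i, j) * w b k l)"
        by (simp add: T_index ij sum_distrib_right)
      finally show "(\<Sum>t<n. \<Sum>u<n. Q $$ (i, u) * ?G u t k l * P $$ (t, j)) = (\<Sum>b\<in>B. T (y b) $$ (i, j) * w b k l)" .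
    qed
    also have "det \<dots> = (\<Prod>i<n. det (mat d d (\<lambda>(k, l). \<Sum>b\<in>B. T (y b) $$ (i, i) * w b k l)))"
      by (rule det_block_mat_upper_triangular) (simp add: T_upper)
    finally show ?thesis
      by (simp add: \<chi>_def)
  qed
  with hom base det show thesis
    using that by blast
qed

end

text \<open>The basis is the one selected in \<open>field_norm\<close>, so that the two matrices
  agree entry by entry, without a change of basis.\<close>

lemma field_norm_eq_det_regular:
  assumes "finite_field_extension h"
  obtains bs where "extension_basis h bs"
    "\<And>a. to_ac (field_norm h a) = det (extension_basis.reg_mat h bs a)"
proof -
  define bs where "bs = (SOME bs. distinct bs \<and> is_basis (ext_scale h) (set bs))"
  have "\<exists>bs. distinct bs \<and> is_basis (ext_scale h) (set bs)"
    using assms finite_distinct_list unfolding finite_field_extension_def by metis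
  then have bs: "distinct bs \<and> is_basis (ext_scale h) (set bs)"
    unfolding bs_def by (rule someI_ex)
  then interpret extension_basis h bs
    using assms by (intro extension_basis.intro) (auto simp: finite_field_extension_def)
  have "extension_basis h bs" ..
  moreover have "to_ac (field_norm h a) = det (reg_mat a)" for a
  proof -
    interpret to_ac: comm_ring_hom "to_ac :: 'a \<Rightarrow> 'a alg_closure"
      by unfold_locales simp_all
    have "reg_mat a = map_mat to_ac (mat n n (\<lambda>(i, j). reg a i j))"
      by (rule eq_matI) (auto simp: reg_mat_def)
    then show ?thesis
      by (simp add: field_norm_def reg_def flip: bs_def)
  qed
  ultimately show thesis
    using that by blast
qed

section \<open>Polynomial identities\<close>

text \<open>The induction frees one coordinate of \<open>x\<close> from \<open>S\<close> at a time.\<close>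

lemma separately_polynomial_eqI:
  fixes f g :: "('b \<Rightarrow> 'k::idom) \<Rightarrow> 'k"
  assumes f: "\<And>x b. \<exists>q. Polynomial.degree q \<le> d \<and> (\<forall>t. poly q t = f (x(b := t)))"
    and g: "\<And>x b. \<exists>q. Polynomial.degree q \<le> d \<and> (\<forall>t. poly q t = g (x(b := t)))"
    and S: "card S > d"
    and "finite B"
    and eq: "\<And>x. (\<forall>b\<in>B. x b \<in> S) \<Longrightarrow> f x = g x"
  shows "f x = g x"
  using \<open>finite B\<close> eq
proof (induction B arbitrary: x rule: finite_induct)
  case empty
  then show ?case by simp
next
  case (insert c B)
  show ?case
  proof (rule insert.IH)
    fix x assume x: "\<forall>b\<in>B. x b \<in> S"
    obtain q r where q: "Polynomial.degree q \<le> d" "\<And>t. poly q t = f (x(c := t))"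
      and r: "Polynomial.degree r \<le> d" "\<And>t. poly r t = g (x(c := t))"
      using f[of x c] g[of x c] by blast
    \<comment> \<open>Along the freed coordinate both functions are polynomials of degree at most
      \<open>d\<close> that agree on the more than \<open>d\<close> points of
      \<open>S\<close>.\<close>
    have "q = r"
    proof (rule poly_eqI_degree)
      fix t assume "t \<in> S"
      then have "f (x(c := t)) = g (x(c := t))"
        using x by (intro insert.prems) auto
      then show "poly q t = poly r t"
        by (simp add: q r)
    qed (use q r S in auto)
    then show "f x = g x"
      using q(2)[of "x c"] r(2)[of "x c"] by simp
  qed
qed

text \<open>The variable \<open>b\<close> becomes the indeterminate and the others constants;
  homogeneity bounds the degree of each monomial. This and the next lemma supply assumptions of
  \<open>separately_polynomial_eqI\<close>.\<close>

lemma eval_poly_along_polynomial_in_variable: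
  fixes g :: "'f::zero \<Rightarrow> 'k::idom"
  assumes "homogeneous_poly d B p"
  shows "\<exists>q. Polynomial.degree q \<le> d \<and> (\<forall>t. poly q t = eval_poly_along g p (x(b := t)))"
proof -
  define factor where "factor b' = (if b' = b then [:0, 1:] else [:x b':])" for b'
  define q where "q = (\<Sum>m\<in>Poly_Mapping.keys p. Polynomial.smult (g (Poly_Mapping.lookup p m))
    (\<Prod>b'\<in>Poly_Mapping.keys m. factor b' ^ Poly_Mapping.lookup m b'))"
  have "Polynomial.degree q \<le> d"
    unfolding q_def
  proof (rule degree_sum_le)
    fix m assume m: "m \<in> Poly_Mapping.keys p"
    have "Polynomial.degree (factor b' ^ e) \<le> e" for b' e
    proof -
      have "Polynomial.degree (factor b') * e \<le> 1 * e"
        by (intro mult_right_mono) (auto simp: factor_def)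
      then show ?thesis
        using degree_power_le[of "factor b'" e] by linarith
    qed
    then have "Polynomial.degree (\<Prod>b'\<in>Poly_Mapping.keys m. factor b' ^ Poly_Mapping.lookup m b') \<le>
        (\<Sum>b'\<in>Poly_Mapping.keys m. Poly_Mapping.lookup m b')"
      by (intro order.trans[OF degree_prod_sum_le] sum_mono) auto
    also have "\<dots> = d"
      using assms m by (auto simp: homogeneous_poly_def)
    finally show "Polynomial.degree (Polynomial.smult (g (Poly_Mapping.lookup p m))
        (\<Prod>b'\<in>Poly_Mapping.keys m. factor b' ^ Poly_Mapping.lookup m b')) \<le> d"
      by (rule order.trans[OF degree_smult_le])
  qed simp
  moreover have "poly q t = eval_poly_along g p (x(b := t))" for t
    unfolding q_def eval_poly_along_def
    by (auto simp: poly_sum poly_prod factor_def intro!: sum.cong prod.cong)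
  ultimately show ?thesis by blast
qed

text \<open>The entries have degree at most 1 in the coordinate at \<open>b\<close>, and the
  determinant has size \<open>d\<close>.\<close>

lemma det_polynomial_in_variable:
  fixes w :: "'b \<Rightarrow> nat \<Rightarrow> nat \<Rightarrow> 'k::idom"
  assumes "finite B"
  shows "\<exists>q. Polynomial.degree q \<le> d \<and>
    (\<forall>t. poly q t = det (mat d d (\<lambda>(k, l). \<Sum>b'\<in>B. (x(b := t)) b' * w b' k l)))"
proof -
  define A where "A = mat d d (\<lambda>(k, l). \<Sum>b'\<in>B. (if b' = b then [:0, w b' k l:] else [:x b' * w b' k l:]))"
  have "Polynomial.degree (det A) \<le> 1 * d"
  proof (rule degree_det_le)
    show "Polynomial.degree (A $$ (i, j)) \<le> 1" if "i < d" "j < d" for i j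
      unfolding A_def using that by (auto intro!: degree_sum_le assms)
  qed (simp add: A_def)
  moreover have "poly (det A) t = det (mat d d (\<lambda>(k, l). \<Sum>b'\<in>B. (x(b := t)) b' * w b' k l))" for t
  proof -
    interpret poly_at: comm_ring_hom "\<lambda>q. poly q t"
      by unfold_locales simp_all
    have "map_mat (\<lambda>q. poly q t) A = mat d d (\<lambda>(k, l). \<Sum>b'\<in>B. (x(b := t)) b' * w b' k l)"
      by (rule eq_matI) (auto simp: A_def poly_sum intro!: sum.cong)
    then show ?thesis
      using poly_at.hom_det[of A] by simp
  qed
  ultimately show ?thesis by auto
qed

lemma eval_poly_along_hom:
  assumes "comm_semiring_hom g"
  shows "g (eval_poly_along h p x) = eval_poly_along (\<lambda>c. g (h c)) p (\<lambda>b. g (x b))"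
proof -
  interpret comm_semiring_hom g by (rule assms)
  show ?thesis
    by (simp add: eval_poly_along_def hom_sum hom_mult hom_prod hom_power)
qed

lemma eval_poly_along_cong:
  assumes "homogeneous_poly d B p" "\<And>b. b \<in> B \<Longrightarrow> x b = y b"
  shows "eval_poly_along g p x = eval_poly_along g p y"
  using assms unfolding eval_poly_along_def homogeneous_poly_def
  by (intro sum.cong arg_cong2[of _ _ _ _ "(*)"] prod.cong) (auto, metis subsetD)

text \<open>Here the characteristic enters: 0, ..., d are distinct in F. They serve as the
  coordinates at which the form and the determinant are compared.\<close>

lemma card_of_nat_image:
  assumes "CHAR('f::field) = 0 \<or> CHAR('f) > d"
  shows "card ((of_nat :: nat \<Rightarrow> 'f) ` {..d}) = Suc d"
proof -
  have "inj_on (of_nat :: nat \<Rightarrow> 'f) {..d}"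
  proof (rule linorder_inj_onI)
    fix i j :: nat assume "i < j" "j \<in> {..d}"
    then have "\<not> CHAR('f) dvd j - i"
      using assms by (auto dest: dvd_imp_le)
    then have "(of_nat (j - i) :: 'f) \<noteq> 0"
      by (simp only: of_nat_eq_0_iff_char_dvd not_False_eq_True)
    then show "(of_nat i :: 'f) \<noteq> of_nat j"
      using \<open>i < j\<close> by (auto simp: of_nat_diff)
  qed auto
  then show ?thesis
    by (simp add: card_image)
qed

lemma is_basis_expansion:
  assumes "vector_space s" "finite B" "is_basis s B"
  obtains x where "v = (\<Sum>b\<in>B. s (x b) b)"
proof -
  interpret vector_space s by (rule assms)
  have "v \<in> span B"
    using assms(3) by (simp add: is_basis_def)
  then show thesis
    using that span_finite[OF assms(2)] by auto
qed

section \<open>The norm principle\<close>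

theorem theorem6:
  fixes scale :: "'f::field \<Rightarrow> 'a::division_ring \<Rightarrow> 'a"
    and d :: nat
    and \<phi> :: "'a \<Rightarrow> 'f"
    and h :: "'f \<Rightarrow> 'k::field"
    and scaleK :: "'k \<Rightarrow> 'w::ab_group_add \<Rightarrow> 'w"
    and \<iota> :: "'a \<Rightarrow> 'w"
    and \<phi>K :: "'w \<Rightarrow> 'k"
    and a :: 'k
  assumes "central_division_algebra scale d"
    and "CHAR('f) = 0 \<or> CHAR('f) > d"
    and "is_reduced_norm scale d \<phi>"
    and "finite_field_extension h"
    and "is_scalar_extension h scale scaleK \<iota>"
    and "is_form_extension h scale scaleK \<iota> d \<phi> \<phi>K"
    and "a \<noteq> 0"
    and "forms_isomorphic scaleK (\<lambda>v. a * \<phi>K v) scaleK \<phi>K"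
  shows "forms_isomorphic scale (\<lambda>v. field_norm h a * \<phi> v) scale \<phi>"
proof -
  interpret central_division_algebra scale d by (rule assms(1))
  interpret h: field_hom h
    using assms(4) by (simp add: finite_field_extension_def)
  have V: "vector_space scale" and W: "vector_space scaleK"
    and \<iota>_add: "\<And>u v. \<iota> (u + v) = \<iota> u + \<iota> v"
    and \<iota>_scale: "\<And>c v. \<iota> (scale c v) = scaleK (h c) (\<iota> v)"
    using assms(5) by (auto simp: is_scalar_extension_def)
  have \<iota>_sum: "\<iota> (\<Sum>b\<in>B. f b) = (\<Sum>b\<in>B. \<iota> (f b))" if "finite B" for f :: "'a \<Rightarrow> 'a" and B
  proof -
    have "\<iota> 0 = 0"
      using \<iota>_add[of 0 0] by simp
    with that show ?thesis
      by (induction B) (simp_all add: \<iota>_add)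
  qed
  obtain \<rho> where "is_splitting scale d \<rho>" and \<phi>: "\<And>v. to_ac (\<phi> v) = det (\<rho> v)"
    using assms(3) by (auto simp: is_reduced_norm_def)
  then interpret matrix_representation \<rho> d
    by unfold_locales (auto simp: is_splitting_def)
  have rep_scale: "\<rho> (scale c v) = to_ac c \<cdot>\<^sub>m \<rho> v" for c v
    using \<open>is_splitting scale d \<rho>\<close> by (auto simp: is_splitting_def)
  have \<phi>_mult: "\<phi> (u * v) = \<phi> u * \<phi> v" for u v
  proof -
    have "to_ac (\<phi> (u * v)) = to_ac (\<phi> u * \<phi> v)"
      by (simp add: \<phi> rep_mult det_mult[of _ d])
    then show ?thesis by (simp only: to_ac_eq_iff)
  qed
  have \<phi>_one: "\<phi> 1 = 1"
    using \<phi>[of 1] by (simp add: rep_one)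
  obtain B p where B: "finite B" "is_basis scale B" "inj_on \<iota> B" "is_basis scaleK (\<iota> ` B)"
    and p: "homogeneous_poly d B p"
    and \<phi>_eval: "\<And>x. \<phi> (\<Sum>b\<in>B. scale (x b) b) = eval_poly_along id p x"
    and \<phi>K_eval: "\<And>y. \<phi>K (\<Sum>b\<in>B. scaleK (y b) (\<iota> b)) = eval_poly_along h p y"
    using assms(6) by (auto simp: is_form_extension_def)

  have rep_combination: "\<rho> (\<Sum>b\<in>B. scale (x b) b) $$ (k, l) = (\<Sum>b\<in>B. to_ac (x b) * \<rho> b $$ (k, l))"
    if "k < d" "l < d" for x k l
    using that by (simp add: rep_sum_index rep_scale)

  \<comment> \<open>At points with coordinates in F both sides are the image of a value of \<phi>.
    Agreement on the grid with coordinates in \<open>S\<close> extends to all points over the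
    algebraic closure, in particular to the images under \<chi> of points over K.\<close>
  have eval_eq_det: "eval_poly_along to_ac p z = det (mat d d (\<lambda>(k, l). \<Sum>b\<in>B. z b * \<rho> b $$ (k, l)))" for z
  proof (rule separately_polynomial_eqI[where f = "eval_poly_along to_ac p"
        and g = "\<lambda>z. det (mat d d (\<lambda>(k, l). \<Sum>b\<in>B. z b * \<rho> b $$ (k, l)))"
        and S = "to_ac ` of_nat ` {..d}" and B = B and d = d])
    have "card (to_ac ` (of_nat :: nat \<Rightarrow> 'f) ` {..d}) = card ((of_nat :: nat \<Rightarrow> 'f) ` {..d})"
      by (rule card_image) (auto simp: inj_on_def)
    then show "d < card (to_ac ` (of_nat :: nat \<Rightarrow> 'f) ` {..d})"
      using card_of_nat_image[OF assms(2)] by simp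
  next
    fix z :: "'a \<Rightarrow> 'f alg_closure"
    assume "\<forall>b\<in>B. z b \<in> to_ac ` of_nat ` {..d}"
    then have "\<forall>b\<in>B. \<exists>c. z b = to_ac c" by blast
    then obtain x where x: "\<And>b. b \<in> B \<Longrightarrow> z b = to_ac (x b)" by metis
    have "eval_poly_along to_ac p z = eval_poly_along to_ac p (\<lambda>b. to_ac (x b))"
      by (rule eval_poly_along_cong[OF p]) (simp add: x)
    also have "\<dots> = to_ac (eval_poly_along id p x)"
      by (subst eval_poly_along_hom) (unfold_locales, simp_all)
    also have "\<dots> = det (\<rho> (\<Sum>b\<in>B. scale (x b) b))"
      by (simp add: \<phi> flip: \<phi>_eval)
    also have "\<rho> (\<Sum>b\<in>B. scale (x b) b) = mat d d (\<lambda>(k, l). \<Sum>b\<in>B. z b * \<rho> b $$ (k, l))"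
      by (rule eq_matI) (simp_all add: rep_combination x)
    finally show "eval_poly_along to_ac p z = det (mat d d (\<lambda>(k, l). \<Sum>b\<in>B. z b * \<rho> b $$ (k, l)))" .
  qed (rule eval_poly_along_polynomial_in_variable[OF p] det_polynomial_in_variable[OF B(1)] B(1))+

  obtain y where y: "a = eval_poly_along h p y"
  proof -
    obtain f where f: "\<And>v. \<phi>K (f v) = a * \<phi>K v"
      using assms(8) by (auto simp: forms_isomorphic_def)
    \<comment> \<open>The coordinates of 1 lie in F, so \<open>\<phi>K\<close> takes the value 1 at
      \<open>\<iota> 1\<close> and hence the value \<open>a\<close> at \<open>f (\<iota> 1)\<close>,
      whose coordinates give the desired \<open>y\<close>.\<close>
    obtain x where x: "1 = (\<Sum>b\<in>B. scale (x b) b)"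
      by (rule is_basis_expansion[OF V B(1,2)])
    have "\<phi>K (\<iota> 1) = eval_poly_along h p (\<lambda>b. h (x b))"
      by (subst x) (simp add: \<iota>_sum B(1) \<iota>_scale \<phi>K_eval)
    also have "\<dots> = h (eval_poly_along id p x)"
      by (subst eval_poly_along_hom) (unfold_locales, simp_all)
    also have "\<dots> = 1"
      by (simp add: \<phi>_one flip: \<phi>_eval x)
    finally have "a = \<phi>K (f (\<iota> 1))"
      by (simp add: f)
    moreover obtain y where "f (\<iota> 1) = (\<Sum>b\<in>\<iota> ` B. scaleK (y b) b)"
      by (rule is_basis_expansion[OF W _ B(4)]) (use B(1) in auto)
    then have "f (\<iota> 1) = (\<Sum>b\<in>B. scaleK (y (\<iota> b)) (\<iota> b))"
      using B(3) by (simp add: sum.reindex)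
    ultimately show thesis
      using that by (simp add: \<phi>K_eval)
  qed

  obtain bs where "extension_basis h bs"
    and norm: "\<And>a. to_ac (field_norm h a) = det (extension_basis.reg_mat h bs a)"
    using field_norm_eq_det_regular[OF assms(4)] by blast
  then interpret K: extension_basis h bs by simp
  obtain \<chi> where hom: "\<forall>i<K.n. field_hom (\<chi> i) \<and> (\<forall>c. \<chi> i (h c) = to_ac c)"
    and det_reg: "\<forall>x. det (K.reg_mat x) = (\<Prod>i<K.n. \<chi> i x)"
    and det_block: "\<forall>(B :: 'a set) d y w.
      det (block_mat K.n d (\<lambda>i j k l. \<Sum>b\<in>B. to_ac (K.reg (y b) i j) * w b k l)) =
      (\<Prod>i<K.n. det (mat d d (\<lambda>(k, l). \<Sum>b\<in>B. \<chi> i (y b) * w b k l)))"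
    using K.exists_diagonal_homs[where 'b = 'a] .
  \<comment> \<open>The entries on the left lie in A: this is the matrix over A obtained from the
    sum of the tensors of \<open>b\<close> with \<open>y b\<close> by letting K act through
    \<open>K.reg\<close>.\<close>
  have "det (rep_mat K.n (\<lambda>i j. \<Sum>b\<in>B. scale (K.reg (y b) i j) b)) =
      det (block_mat K.n d (\<lambda>i j k l. \<Sum>b\<in>B. to_ac (K.reg (y b) i j) * \<rho> b $$ (k, l)))"
    unfolding rep_mat_def
    by (rule arg_cong[of _ _ det], rule block_mat_cong) (rule rep_combination)
  also have "\<dots> = (\<Prod>i<K.n. eval_poly_along to_ac p (\<lambda>b. \<chi> i (y b)))"
    by (simp add: det_block eval_eq_det)
  also have "\<dots> = (\<Prod>i<K.n. \<chi> i a)"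
  proof (rule prod.cong[OF refl])
    fix i assume "i \<in> {..<K.n}"
    then have i: "i < K.n" by simp
    interpret \<chi>: field_hom "\<chi> i" using hom i by blast
    \<comment> \<open>Since \<open>\<chi> i\<close> extends \<open>to_ac\<close> along
      \<open>h\<close>, it carries the value of \<open>p\<close> at \<open>y\<close> to its value at
      the image of \<open>y\<close>.\<close>
    have "\<chi> i a = eval_poly_along (\<lambda>c. \<chi> i (h c)) p (\<lambda>b. \<chi> i (y b))"
      unfolding y by (rule eval_poly_along_hom) (rule \<chi>.comm_semiring_hom_axioms)
    then show "eval_poly_along to_ac p (\<lambda>b. \<chi> i (y b)) = \<chi> i a"
      using hom i by simp
  qed
  also have "\<dots> = to_ac (field_norm h a)"
    by (simp add: norm det_reg)
  finally have norm_eq: "det (rep_mat K.n (\<lambda>i j. \<Sum>b\<in>B. scale (K.reg (y b) i j) b)) = to_ac (field_norm h a)" .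
  obtain v where "to_ac (field_norm h a) = det (\<rho> v)"
    using det_rep_mat_is_norm[of K.n "\<lambda>i j. \<Sum>b\<in>B. scale (K.reg (y b) i j) b"] unfolding norm_eq by blast
  then have v: "field_norm h a = \<phi> v"
    by (simp flip: \<phi>)
  have "(\<Prod>i<K.n. \<chi> i a) \<noteq> 0"
  proof -
    have "\<chi> i a \<noteq> 0" if "i < K.n" for i
    proof -
      interpret \<chi>: field_hom "\<chi> i" using hom that by blast
      show ?thesis using assms(7) by simp
    qed
    then show ?thesis by simp
  qed
  then have "field_norm h a \<noteq> 0"
    using norm[of a] by (auto simp: det_reg)
  \<comment> \<open>Left multiplication must be invertible, so a nonzero \<open>u\<close> is wanted.
    If \<open>v = 0\<close>, then \<open>\<phi> v\<close> is idempotent and nonzero, hence equal to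
    \<open>\<phi> 1\<close>, and 1 serves as \<open>u\<close>.\<close>
  obtain u where u: "u \<noteq> 0" "field_norm h a = \<phi> u"
  proof (cases "v = 0")
    case True
    then have "\<phi> v * \<phi> v = \<phi> v"
      by (simp flip: \<phi>_mult)
    then have "field_norm h a = \<phi> 1"
      using \<open>field_norm h a \<noteq> 0\<close> by (simp add: v \<phi>_one)
    then show thesis
      using that[of 1] by simp
  qed (use v that in blast)
  have "Vector_Spaces.linear scale scale ((*) u)"
    by unfold_locales (simp_all add: distrib_left scale_mult_right)
  moreover have "bij ((*) u)"
    by (rule bij_betw_byWitness[where f' = "(*) (inverse u)"])
      (use u in \<open>auto simp flip: mult.assoc\<close>)
  ultimately show ?thesis
    unfolding forms_isomorphic_def by (intro exI[of _ "(*) u"]) (simp add: \<phi>_mult u)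
qed

end
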